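(* Let $K$ be a field and $E$ a finite graph in which no two distinct cycles have a common vertex. Then $L_K(E)$ has Invariant Basis Number.
   Context: A (directed) graph $E=(E^0,E^1,s,r)$ consists of two disjoint sets $E^0$ (vertices) and $E^1$ (edges) and maps $s,r:E^1\to E^0$ (source and range). It is finite if $E^0$ and $E^1$ are finite; $E^0$ is assumed nonempty. A vertex $v$ is regular if $0<|s^{-1}(v)|<\infty$. A path is a sequence of edges $p=e_1\cdots e_n$ ($n\ge 1$) with $r(e_i)=s(e_{i+1})$; $s(p)=s(e_1)$, $r(p)=r(e_n)$. A cycle is a path $p$ with $s(p)=r(p)$ that does not revisit any other vertex (i.e. $s(e_1),\dots,s(e_n)$ are distinct). Cycles that differ only by a cyclic permutation of their edges are not regarded as distinct. For a field $K$, the Leavitt path algebra $L_K(E)$ is the $K$-algebra generated by $\{v,e,e^*\mid v\in E^0,e\in E^1\}$ subject to, for all $v,w\in E^0$, $e,f\in E^1$: (1) $vw=\delta_{v,w}w$; (2) $s(e)e=e=e\,r(e)$ and $r(e)e^*=e^*=e^*s(e)$; (3) $e^*f=\delta_{e,f}r(e)$; (4) $v=\sum_{e\in s^{-1}(v)}ee^*$ for every regular vertex $v$. For finite $E$ it is unital with identity $\sum_{v\in E^0}v$. A unital ring $R$ has Invariant Basis Number if for all positive integers $m,n$, $R^m\cong R^n$ as right $R$-modules implies $m=n$. *)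

theory Defs
  imports
    "HOL-Algebra.QuotRing"
    "HOL-Library.FuncSet"
    "HOL-Library.Poly_Mapping"
    "Graph_Theory.Arc_Walk"
begin

text \<open>
  Cycles are counted up to cyclic permutation of their edges. Since a cycle is closed, the
  sources of its edges are all of its vertices.
\<close>
definition same_cycle :: "'e list \<Rightarrow> 'e list \<Rightarrow> bool" where
  "same_cycle p q \<longleftrightarrow> (\<exists>k. q = rotate k p)"

definition disjoint_cycles :: "('v, 'e) pre_digraph \<Rightarrow> bool" where
  "disjoint_cycles E \<longleftrightarrow>
     (\<forall>p q. pre_digraph.cycle E p \<and> pre_digraph.cycle E q \<and> \<not> same_cycle p q
        \<longrightarrow> tail E ` set p \<inter> tail E ` set q = {})"

definition regular_vertex :: "('v, 'e) pre_digraph \<Rightarrow> 'v \<Rightarrow> bool" where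
  "regular_vertex E v \<longleftrightarrow> v \<in> verts E \<and> finite (out_arcs E v) \<and> out_arcs E v \<noteq> {}"

datatype 'g fword = Word (letters: "'g list")

instantiation fword :: (type) monoid_add
begin

definition "0 = Word []"
definition "u + w = Word (letters u @ letters w)"

instance
  by standard (simp_all add: zero_fword_def plus_fword_def)

end

datatype ('v, 'e) gen = Vertex 'v | Edge 'e | Ghost 'e

text \<open>
  Because words form a monoid under concatenation, the product that \<^theory>\<open>HOL-Library.Poly_Mapping\<close>
  puts on finitely supported functions is the (noncommutative) product of the free algebra.
\<close>
type_synonym ('k, 'v, 'e) free_alg = "('v, 'e) gen fword \<Rightarrow>\<^sub>0 'k"

definition gen_elem :: "('v, 'e) gen \<Rightarrow> ('k :: field, 'v, 'e) free_alg" where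
  "gen_elem g = Poly_Mapping.single (Word [g]) 1"

abbreviation "vert v \<equiv> gen_elem (Vertex v)"
abbreviation "edge e \<equiv> gen_elem (Edge e)"
abbreviation "ghost e \<equiv> gen_elem (Ghost e)"

definition graph_gens :: "('v, 'e) pre_digraph \<Rightarrow> ('v, 'e) gen set" where
  "graph_gens E = Vertex ` verts E \<union> Edge ` arcs E \<union> Ghost ` arcs E"

definition free_algebra :: "('v, 'e) pre_digraph \<Rightarrow> ('k :: field, 'v, 'e) free_alg ring" where
  "free_algebra E =
     \<lparr>carrier = {f. \<forall>w \<in> Poly_Mapping.keys f. set (letters w) \<subseteq> graph_gens E},
      monoid.mult = (*), one = 1, ring.zero = 0, add = (+)\<rparr>"

definition free_nonunital :: "('v, 'e) pre_digraph \<Rightarrow> ('k :: field, 'v, 'e) free_alg set" where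
  "free_nonunital E = {f \<in> carrier (free_algebra E). Poly_Mapping.lookup f 0 = 0}"

text \<open>An element \<^term>\<open>a - b\<close> stands for the relation \<^term>\<open>a = b\<close>.\<close>
definition leavitt_relations :: "('v, 'e) pre_digraph \<Rightarrow> ('k :: field, 'v, 'e) free_alg set" where
  "leavitt_relations E =
     {vert v * vert w - (if v = w then vert w else 0) | v w. v \<in> verts E \<and> w \<in> verts E}
   \<union> {vert (tail E e) * edge e - edge e | e. e \<in> arcs E}
   \<union> {edge e * vert (head E e) - edge e | e. e \<in> arcs E}
   \<union> {vert (head E e) * ghost e - ghost e | e. e \<in> arcs E}
   \<union> {ghost e * vert (tail E e) - ghost e | e. e \<in> arcs E}
   \<union> {ghost e * edge f - (if e = f then vert (head E e) else 0) | e f. e \<in> arcs E \<and> f \<in> arcs E}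
   \<union> {vert v - (\<Sum>e \<in> out_arcs E v. edge e * ghost e) | v. regular_vertex E v}"

definition leavitt_ideal :: "('v, 'e) pre_digraph \<Rightarrow> ('k :: field, 'v, 'e) free_alg set" where
  "leavitt_ideal E = genideal (free_algebra E) (leavitt_relations E)"

text \<open>
  The algebra generated by the symbols is not required to contain the unit of the free unital
  algebra: it is the free algebra without unit modulo the relations, which for finite \<^term>\<open>E\<close> has
  the sum of the vertices as its identity. The ideal generated by the relations lies in
  \<^const>\<open>free_nonunital\<close> and is stable under scalars, so it does not matter that it is generated
  inside the free unital algebra.
\<close>
definition leavitt_path_algebra ::
    "'k :: field itself \<Rightarrow> ('v, 'e) pre_digraph \<Rightarrow> ('k, 'v, 'e) free_alg set ring" where
  "leavitt_path_algebra K E =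
     (free_algebra E Quot leavitt_ideal E)
       \<lparr>carrier := (\<lambda>f. leavitt_ideal E +>\<^bsub>free_algebra E\<^esub> f) ` free_nonunital E,
        one := leavitt_ideal E +>\<^bsub>free_algebra E\<^esub> (\<Sum>v \<in> verts E. vert v)\<rparr>"

definition free_right_module :: "('a, 'b) ring_scheme \<Rightarrow> nat \<Rightarrow> (nat \<Rightarrow> 'a) set" where
  "free_right_module R n = {..<n} \<rightarrow>\<^sub>E carrier R"

definition free_right_module_iso ::
    "('a, 'b) ring_scheme \<Rightarrow> nat \<Rightarrow> nat \<Rightarrow> ((nat \<Rightarrow> 'a) \<Rightarrow> nat \<Rightarrow> 'a) \<Rightarrow> bool" where
  "free_right_module_iso R m n \<phi> \<longleftrightarrow>
     bij_betw \<phi> (free_right_module R m) (free_right_module R n) \<and>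
     (\<forall>x \<in> free_right_module R m. \<forall>y \<in> free_right_module R m.
        \<phi> (\<lambda>i\<in>{..<m}. x i \<oplus>\<^bsub>R\<^esub> y i) = (\<lambda>i\<in>{..<n}. \<phi> x i \<oplus>\<^bsub>R\<^esub> \<phi> y i)) \<and>
     (\<forall>x \<in> free_right_module R m. \<forall>r \<in> carrier R.
        \<phi> (\<lambda>i\<in>{..<m}. x i \<otimes>\<^bsub>R\<^esub> r) = (\<lambda>i\<in>{..<n}. \<phi> x i \<otimes>\<^bsub>R\<^esub> r))"

text \<open>HOL-Algebra rings have a unit; it need not differ from zero.\<close>
definition invariant_basis_number :: "('a, 'b) ring_scheme \<Rightarrow> bool" where
  "invariant_basis_number R \<longleftrightarrow>
     ring R \<and>
     (\<forall>m n. 0 < m \<and> 0 < n \<and> (\<exists>\<phi>. free_right_module_iso R m n \<phi>) \<longrightarrow> m = n)"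

lemma free_algebra_carrier_iff:
  "f \<in> carrier (free_algebra E) \<longleftrightarrow>
     Poly_Mapping.keys f \<subseteq> {w. set (letters w) \<subseteq> graph_gens E}"
  by (auto simp: free_algebra_def)

lemma free_algebra_simps:
  "f \<otimes>\<^bsub>free_algebra E\<^esub> g = f * g" "f \<oplus>\<^bsub>free_algebra E\<^esub> g = f + g"
  "\<one>\<^bsub>free_algebra E\<^esub> = 1" "\<zero>\<^bsub>free_algebra E\<^esub> = 0"
  by (simp_all add: free_algebra_def)

lemma free_algebra_closed:
  fixes f g :: "('k :: field, 'v, 'e) free_alg"
  assumes "f \<in> carrier (free_algebra E)" "g \<in> carrier (free_algebra E)"
  shows "f + g \<in> carrier (free_algebra E)"
    and "f - g \<in> carrier (free_algebra E)"
    and "f * g \<in> carrier (free_algebra E)"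
proof -
  let ?W = "{w. set (letters w) \<subseteq> graph_gens E}"
  have f: "Poly_Mapping.keys f \<subseteq> ?W" and g: "Poly_Mapping.keys g \<subseteq> ?W"
    using assms by (simp_all only: free_algebra_carrier_iff)
  show "f + g \<in> carrier (free_algebra E)"
    unfolding free_algebra_carrier_iff using f g Poly_Mapping.keys_add[of f g] by blast
  show "f - g \<in> carrier (free_algebra E)"
    unfolding free_algebra_carrier_iff using f g Poly_Mapping.keys_diff[of f g] by blast
  have W: "u + w \<in> ?W" if "u \<in> ?W" "w \<in> ?W" for u w
    using that by (simp add: plus_fword_def)
  have "{u + w | u w. u \<in> Poly_Mapping.keys f \<and> w \<in> Poly_Mapping.keys g} \<subseteq> ?W"
    using f g W by blast
  then show "f * g \<in> carrier (free_algebra E)"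
    unfolding free_algebra_carrier_iff using Poly_Mapping.keys_mult[of f g] by (rule order_trans[rotated])
qed

lemma free_algebra_ring: "ring (free_algebra E :: ('k :: field, 'v, 'e) free_alg ring)"
proof -
  let ?F = "free_algebra E :: ('k, 'v, 'e) free_alg ring"
  have add: "f + g \<in> carrier ?F" and mult: "f * g \<in> carrier ?F"
    if "f \<in> carrier ?F" "g \<in> carrier ?F" for f g
    using that by (rule free_algebra_closed)+
  have neg: "- f \<in> carrier ?F" if "f \<in> carrier ?F" for f
    using that by (simp add: free_algebra_def)
  have one: "1 \<in> carrier ?F" and zero: "0 \<in> carrier ?F"
    by (simp_all add: free_algebra_def zero_fword_def)
  show ?thesis
  proof (rule ringI)
    show "abelian_group ?F"
    proof (rule abelian_groupI)
      fix f assume "f \<in> carrier ?F"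
      then show "\<exists>g \<in> carrier ?F. g \<oplus>\<^bsub>?F\<^esub> f = \<zero>\<^bsub>?F\<^esub>"
        using neg by (intro bexI[of _ "- f"]) (simp_all add: free_algebra_simps)
    qed (simp_all add: free_algebra_simps add zero ac_simps)
    show "monoid ?F"
      by (rule monoidI) (simp_all add: free_algebra_simps mult one mult.assoc)
  qed (simp_all add: free_algebra_simps distrib_left distrib_right)
qed

lemma free_nonunital_closed:
  fixes f g :: "('k :: field, 'v, 'e) free_alg"
  shows "f \<in> free_nonunital E \<Longrightarrow> g \<in> free_nonunital E \<Longrightarrow> f + g \<in> free_nonunital E"
    and "f \<in> free_nonunital E \<Longrightarrow> g \<in> free_nonunital E \<Longrightarrow> f - g \<in> free_nonunital E"
    and "f \<in> free_nonunital E \<Longrightarrow> g \<in> carrier (free_algebra E) \<Longrightarrow> f * g \<in> free_nonunital E"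
    and "f \<in> free_nonunital E \<Longrightarrow> g \<in> carrier (free_algebra E) \<Longrightarrow> g * f \<in> free_nonunital E"
proof -
  show "f + g \<in> free_nonunital E" if "f \<in> free_nonunital E" "g \<in> free_nonunital E"
    using that by (simp add: free_nonunital_def free_algebra_closed lookup_add)
  show "f - g \<in> free_nonunital E" if "f \<in> free_nonunital E" "g \<in> free_nonunital E"
    using that by (simp add: free_nonunital_def free_algebra_closed lookup_minus)
  have sum0: "u = 0 \<and> w = 0" if "0 = u + w" for u w :: "('v, 'e) gen fword"
    using that by (cases u; cases w) (simp add: zero_fword_def plus_fword_def)
  have mult: "h * k \<in> free_nonunital E"
    if "h \<in> carrier (free_algebra E)" "k \<in> carrier (free_algebra E)"
      "0 \<notin> Poly_Mapping.keys h \<or> 0 \<notin> Poly_Mapping.keys k"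
    for h k :: "('k, 'v, 'e) free_alg"
  proof -
    have "0 \<notin> Poly_Mapping.keys (h * k)"
      using that(3) sum0 Poly_Mapping.keys_mult[of h k] by blast
    moreover have "h * k \<in> carrier (free_algebra E)"
      using that(1,2) by (rule free_algebra_closed)
    ultimately show ?thesis
      by (simp add: free_nonunital_def in_keys_iff)
  qed
  show "f * g \<in> free_nonunital E" "g * f \<in> free_nonunital E"
    if "f \<in> free_nonunital E" "g \<in> carrier (free_algebra E)"
    using that mult[of f g] mult[of g f] by (simp_all add: free_nonunital_def in_keys_iff)
qed

lemma gen_elem_in_free_nonunital:
  "g \<in> graph_gens E \<Longrightarrow> gen_elem g \<in> free_nonunital E"
  by (simp add: gen_elem_def free_nonunital_def free_algebra_def lookup_single zero_fword_def)

lemma leavitt_relations_subset: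
  assumes "wf_digraph E"
  shows "(leavitt_relations E :: ('k :: field, 'v, 'e) free_alg set) \<subseteq> free_nonunital E"
proof -
  let ?N = "free_nonunital E :: ('k, 'v, 'e) free_alg set"
  interpret wf_digraph E by fact
  have v: "v \<in> verts E \<Longrightarrow> vert v \<in> ?N" and e: "e \<in> arcs E \<Longrightarrow> edge e \<in> ?N"
    and g: "e \<in> arcs E \<Longrightarrow> ghost e \<in> ?N" for v e
    by (auto intro!: gen_elem_in_free_nonunital simp: graph_gens_def)
  have z: "0 \<in> ?N"
    by (simp add: free_nonunital_def free_algebra_def)
  have m: "a \<in> ?N \<Longrightarrow> b \<in> ?N \<Longrightarrow> a * b \<in> ?N" for a b
    by (rule free_nonunital_closed(3)) (auto simp: free_nonunital_def)
  have s: "(\<Sum>e \<in> A. edge e * ghost e) \<in> ?N" if "finite A" "A \<subseteq> arcs E" for A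
    using that by (induction A rule: finite_induct)
      (auto intro!: z m e g free_nonunital_closed(1))
  have o: "out_arcs E v \<subseteq> arcs E" for v
    by (auto simp: out_arcs_def)
  show ?thesis
    unfolding leavitt_relations_def
    by (auto intro!: free_nonunital_closed(2) m v e g z s o simp: regular_vertex_def)
qed

lemma leavitt_ideal_ideal:
  assumes "wf_digraph E"
  shows "ideal (leavitt_ideal E :: ('k :: field, 'v, 'e) free_alg set) (free_algebra E)"
  unfolding leavitt_ideal_def
  by (rule ring.genideal_ideal[OF free_algebra_ring])
    (use leavitt_relations_subset[OF assms] in \<open>auto simp: free_nonunital_def\<close>)

end

theory Submission
  imports Defs "HOL-Library.Function_Algebras"
begin

text \<open>
  A ring with a unital homomorphism to the \<open>N \<times> N\<close> matrices over a field, \<open>N > 0\<close>, has invariant basis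
  number: an isomorphism between free modules of ranks \<open>m\<close> and \<open>n\<close> becomes an invertible matrix of
  size \<open>nN \<times> mN\<close>. So it suffices to find a nonzero finite-dimensional representation of the Leavitt
  path algebra, and for this a nonzero weight \<open>d\<close> on the vertices with values in the natural numbers
  such that \<open>d v = (\<Sum>e \<in> out_arcs E v. d (head E e))\<close> at every regular vertex: partition
  \<open>{..<d v}\<close> into blocks of sizes \<open>d (head E e)\<close> and let edges and ghosts act as the partial
  bijections between the blocks and the sets \<open>{..<d (head E e)}\<close>.

  If \<open>E\<close> is acyclic, \<open>d v\<close> counts the paths from \<open>v\<close> to a fixed sink. Otherwise choose a cycle that
  no other cycle reaches; \<open>d v\<close> counts the paths from \<open>v\<close> that end on first meeting this cycle. As
  cycles are disjoint, each vertex on it has exactly one outgoing edge from which the cycle can be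
  reached, which makes \<open>d\<close> balanced there too.
\<close>

section \<open>Balanced weights on graphs with disjoint cycles\<close>

lemma (in pre_digraph) cas_awalk_verts:
  "cas u p v \<Longrightarrow> awalk_verts u p = map (tail G) p @ [v]"
  by (induction p arbitrary: u) auto

text \<open>Closing each arc by a path back to its tail gives two cycles through a common vertex,
  hence the same cycle up to rotation. A cycle leaves each of its vertices by one arc.\<close>

lemma (in wf_digraph) disjoint_cycles_return_arc_unique:
  assumes disj: "disjoint_cycles G"
    and ef: "e \<in> arcs G" "f \<in> arcs G" "tail G e = tail G f"
    and ret: "head G e \<rightarrow>\<^sup>* tail G e" "head G f \<rightarrow>\<^sup>* tail G f"
  shows "e = f"
proof -
  from ret obtain p q where p: "apath (head G e) p (tail G e)" and q: "apath (head G f) q (tail G f)"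
    by (auto simp: reachable_apath)
  \<comment> \<open>The path \<open>p\<close> visits \<open>tail G e\<close> at its end; by
    distinctness of its vertices no arc of \<open>p\<close> starts there. So \<open>e\<close> is the
    sole arc of \<open>e # p\<close> with this tail.\<close>
  have ends: "awalk_verts (head G e) p = map (tail G) p @ [tail G e]"
    using p by (intro cas_awalk_verts) (auto simp: apath_def awalk_def)
  have "awalk (tail G e) (e # p) (tail G e)" "awalk (tail G f) (f # q) (tail G f)"
    using p q ef by (auto simp: apath_def awalk_Cons_iff)
  then have "cycle (e # p)" "cycle (f # q)"
    using p q ef(3) by (auto simp: cycle_def apath_def intro!: exI[of _ "tail G e"])
  moreover have "tail G ` set (e # p) \<inter> tail G ` set (f # q) \<noteq> {}"
    using ef by auto
  ultimately have "same_cycle (e # p) (f # q)"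
    using disj unfolding disjoint_cycles_def by blast
  then have "f \<in> set (e # p)"
    unfolding same_cycle_def by (metis list.set_intros(1) set_rotate)
  moreover have "tail G e \<notin> tail G ` set p"
    using p ends by (auto simp: apath_def)
  ultimately show ?thesis using ef by force
qed

text \<open>The pairs run from head to tail so that a recursion at a vertex may consult the heads of
  its outgoing arcs. A loop of the relation would be a closed walk ending with an arc of
  \<open>A\<close>, whose head then reaches its tail.\<close>

lemma (in fin_digraph) wf_no_return_arcs:
  assumes "A \<subseteq> arcs G" and no_return: "\<And>e. e \<in> A \<Longrightarrow> \<not> head G e \<rightarrow>\<^sup>* tail G e"
  shows "wf ((\<lambda>e. (head G e, tail G e)) ` A)" (is "wf ?r")
proof (rule finite_acyclic_wf)
  show "finite ?r"
    using finite_subset[OF assms(1) finite_arcs] by simp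
  have reach: "y \<rightarrow>\<^sup>* x" if "(x, y) \<in> ?r\<^sup>*" "x \<in> verts G" for x y
    using that
  proof (induction rule: rtrancl_induct)
    case (step y z)
    then obtain e where "e \<in> arcs G" "y = head G e" "z = tail G e"
      using assms(1) by auto
    then have "z \<rightarrow> y" by (auto intro: in_arcs_imp_in_arcs_ends)
    then show ?case using step by (auto intro: adj_reachable_trans)
  qed simp
  show "acyclic ?r"
  proof (rule acyclicI, rule allI, rule notI)
    fix x assume "(x, x) \<in> ?r\<^sup>+"
    from tranclD2[OF this] obtain y where y: "(x, y) \<in> ?r\<^sup>*" "(y, x) \<in> ?r"
      by blast
    then obtain e where "e \<in> A" "y = head G e" "x = tail G e" by auto
    with reach[OF y(1)] no_return[of e] assms(1) show False by auto
  qed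
qed

text \<open>In a graph this amounts to lying on a cycle, since a return walk can be shortened to a
  path.\<close>

definition (in pre_digraph) on_closed_walk :: "'a \<Rightarrow> bool" where
  "on_closed_walk v \<longleftrightarrow> (\<exists>e \<in> arcs G. tail G e = v \<and> head G e \<rightarrow>\<^sup>* v)"

text \<open>The last property says that every closed walk leading to \<open>v0\<close> lies in the
  strong component of \<open>v0\<close>. Without closed walks, well-foundedness yields a sink;
  otherwise a vertex on a closed walk that reaches as many vertices as possible will do.\<close>

lemma (in fin_digraph) exists_sink_or_initial_cycle:
  assumes "verts G \<noteq> {}"
  obtains v0 where "v0 \<in> verts G" "out_arcs G v0 = {} \<or> on_closed_walk v0"
    "\<And>u. on_closed_walk u \<Longrightarrow> u \<rightarrow>\<^sup>* v0 \<Longrightarrow> v0 \<rightarrow>\<^sup>* u"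
proof (cases "\<exists>v. on_closed_walk v")
  case False
  have "wf ((\<lambda>e. (head G e, tail G e)) ` arcs G)"
    using False by (intro wf_no_return_arcs) (auto simp: on_closed_walk_def)
  moreover obtain w where "w \<in> verts G" using assms by auto
  ultimately obtain v where v: "v \<in> verts G"
    "\<And>y. (y, v) \<in> (\<lambda>e. (head G e, tail G e)) ` arcs G \<Longrightarrow> y \<notin> verts G"
    by (rule wfE_min) blast
  have "e \<notin> out_arcs G v" for e
    using v(2)[of "head G e"] by (auto intro: rev_image_eqI)
  then have "out_arcs G v = {}" by blast
  with v(1) False show thesis by (intro that[of v]) auto
next
  case True
  define R where "R v = {w. v \<rightarrow>\<^sup>* w}" for v
  have R_verts: "R v \<subseteq> verts G" for v
    by (auto simp: R_def intro: reachable_in_verts)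
  then have "card (R v) < Suc (card (verts G))" for v
    by (intro le_imp_less_Suc card_mono finite_verts)
  with True obtain v where v: "on_closed_walk v" "\<And>u. on_closed_walk u \<Longrightarrow> card (R u) \<le> card (R v)"
    using ex_has_greatest_nat[of on_closed_walk _ "\<lambda>v. card (R v)"] by metis
  have "v \<rightarrow>\<^sup>* u" if "on_closed_walk u" "u \<rightarrow>\<^sup>* v" for u
  proof -
    \<comment> \<open>Maximality of \<open>card (R v)\<close> forces equality, and \<open>u\<close>
      lies in \<open>R u\<close>.\<close>
    have "R v \<subseteq> R u"
      using that(2) by (auto simp: R_def intro: reachable_trans)
    then have "R v = R u"
      using v(2)[OF that(1)] finite_subset[OF R_verts finite_verts] by (intro card_seteq)
    then show ?thesis
      using that(2) by (auto simp: R_def intro: reachable_in_verts)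
  qed
  with v(1) show thesis by (intro that[of v]) (auto simp: on_closed_walk_def)
qed

lemma (in fin_digraph) exists_balanced_weight:
  assumes "verts G \<noteq> {}" and "disjoint_cycles G"
  obtains d :: "'a \<Rightarrow> nat" and v where "v \<in> verts G" "0 < d v"
    "\<And>u. regular_vertex G u \<Longrightarrow> d u = (\<Sum>e \<in> out_arcs G u. d (head G e))"
proof -
  obtain v0 where v0: "v0 \<in> verts G" "out_arcs G v0 = {} \<or> on_closed_walk v0"
    "\<And>u. on_closed_walk u \<Longrightarrow> u \<rightarrow>\<^sup>* v0 \<Longrightarrow> v0 \<rightarrow>\<^sup>* u"
    using exists_sink_or_initial_cycle[OF assms(1)] by metis
  \<comment> \<open>The strong component of \<open>v0\<close>: just \<open>v0\<close> if it is a
    sink, otherwise the vertices of the chosen cycle.\<close>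
  define C where "C = {u. u \<rightarrow>\<^sup>* v0 \<and> v0 \<rightarrow>\<^sup>* u}"
  \<comment> \<open>The arcs along which the path count is propagated backwards from
    \<open>C\<close>.\<close>
  define A where "A = {e \<in> arcs G. tail G e \<notin> C \<and> tail G e \<rightarrow>\<^sup>* v0}"
  define r where "r = (\<lambda>e. (head G e, tail G e)) ` A"
  have "wf r"
    unfolding r_def
  proof (rule wf_no_return_arcs)
    show "A \<subseteq> arcs G" by (auto simp: A_def)
    fix e assume "e \<in> A"
    \<comment> \<open>Otherwise the tail would be on a closed walk that leads to \<open>v0\<close>,
      and so in \<open>C\<close> by the choice of \<open>v0\<close>.\<close>
    then show "\<not> head G e \<rightarrow>\<^sup>* tail G e"
      using v0(3)[of "tail G e"] by (auto simp: A_def C_def on_closed_walk_def)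
  qed
  define F where "F g v = (if v \<in> C then 1 else if v \<rightarrow>\<^sup>* v0 then (\<Sum>e \<in> out_arcs G v. g (head G e)) else 0)"
    for g :: "'a \<Rightarrow> nat" and v
  define d where "d = wfrec r F"
  have rec: "d v = F (cut d r v) v" for v
    using wfrec[OF \<open>wf r\<close>] by (simp add: d_def)
  have d_C: "d v = 1" if "v \<in> C" for v
    using that by (simp add: rec[of v] F_def)
  have d_0: "d v = 0" if "\<not> v \<rightarrow>\<^sup>* v0" for v
    using that by (simp add: rec[of v] F_def C_def)
  \<comment> \<open>All arcs out of such a \<open>v\<close> lie in \<open>A\<close>, so
    \<open>cut\<close> leaves \<open>d\<close> unchanged at their heads.\<close>
  have d_sum: "d v = (\<Sum>e \<in> out_arcs G v. d (head G e))" if "v \<notin> C" "v \<rightarrow>\<^sup>* v0" for v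
    using that by (auto simp: rec[of v] F_def cut_def r_def A_def intro!: sum.cong)
  show thesis
  proof
    show "v0 \<in> verts G" by fact
    then show "0 < d v0" using d_C[of v0] by (auto simp: C_def)
  next
    fix u assume "regular_vertex G u"
    then have u: "u \<in> verts G" "out_arcs G u \<noteq> {}"
      by (auto simp: regular_vertex_def)
    show "d u = (\<Sum>e \<in> out_arcs G u. d (head G e))"
    proof (cases "u \<rightarrow>\<^sup>* v0")
      case False
      have "\<not> head G e \<rightarrow>\<^sup>* v0" if "e \<in> out_arcs G u" for e
        using that False by (auto dest!: in_arcs_imp_in_arcs_ends intro: adj_reachable_trans)
      then show ?thesis using False by (auto simp: d_0)
    next
      case reach: True
      show ?thesis
      proof (cases "u \<in> C")
        case False
        with reach show ?thesis by (intro d_sum)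
      next
        case True
        \<comment> \<open>Some arc out of \<open>u\<close> continues inside \<open>C\<close>: at
          \<open>v0\<close> itself because a regular vertex is no sink, elsewhere as the first arc
          of a path to \<open>v0\<close>.\<close>
        have "\<exists>e \<in> out_arcs G u. head G e \<rightarrow>\<^sup>* v0"
        proof (cases "u = v0")
          case True
          then show ?thesis using v0(2) u by (auto simp: on_closed_walk_def)
        next
          case False
          with reach obtain p where p: "apath u p v0" "p \<noteq> []"
            by (metis apath_Nil_iff reachable_apath)
          then obtain e p' where "p = e # p'" by (cases p) auto
          with p have "e \<in> out_arcs G u" "head G e \<rightarrow>\<^sup>* v0"
            by (auto simp: apath_Cons_iff reachable_apath)
          then show ?thesis by auto
        qed
        then obtain e where e: "e \<in> out_arcs G u" "head G e \<rightarrow>\<^sup>* v0" by auto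
        \<comment> \<open>A second arc with nonzero weight at its head would lead to
          \<open>v0\<close> and from there back to \<open>u\<close>, against the uniqueness of the
          return arc.\<close>
        have other: "d (head G f) = 0" if "f \<in> out_arcs G u - {e}" for f
        proof (rule ccontr)
          assume "d (head G f) \<noteq> 0"
          then have "head G f \<rightarrow>\<^sup>* v0" by (rule contrapos_np) (rule d_0)
          with that e True have "f = e"
            by (intro disjoint_cycles_return_arc_unique[OF assms(2)])
              (auto simp: C_def intro: reachable_trans)
          with that show False by auto
        qed
        have "u \<rightarrow> head G e"
          using e(1) by (auto intro: in_arcs_imp_in_arcs_ends)
        then have "head G e \<in> C"
          using e(2) True by (auto simp: C_def intro: reachable_adj_trans)
        then have "(\<Sum>f \<in> out_arcs G u. d (head G f)) = 1"
          using e(1) other by (subst sum.remove[of _ e]) (auto simp: d_C)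
        with True show ?thesis by (simp add: d_C)
      qed
    qed
  qed
qed

section \<open>Rings with a matrix representation\<close>

text \<open>The equation \<open>A B = 1\<close> writes each unit vector as a combination of the rows
  of \<open>B\<close>, so \<open>card I\<close> independent vectors lie in the span of
  \<open>card J\<close> vectors.\<close>

lemma card_le_if_matrix_right_inverse:
  fixes A :: "'i \<Rightarrow> 'j \<Rightarrow> 'k :: field" and B :: "'j \<Rightarrow> 'i \<Rightarrow> 'k"
  assumes fin: "finite I" "finite J"
    and AB: "\<And>i k. i \<in> I \<Longrightarrow> k \<in> I \<Longrightarrow> (\<Sum>j \<in> J. A i j * B j k) = (if i = k then 1 else 0)"
  shows "card I \<le> card J"
proof -
  let ?s = "\<lambda>(c :: 'k) (f :: 'i \<Rightarrow> 'k) x. c * f x"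
  interpret vector_space ?s
    by unfold_locales (auto simp: plus_fun_def algebra_simps)
  have sum_fun: "sum f S x = (\<Sum>s \<in> S. f s x)" for f :: "'c \<Rightarrow> 'i \<Rightarrow> 'k" and S x
    by (induction S rule: infinite_finite_induct) (auto simp: zero_fun_def plus_fun_def)
  define u :: "'i \<Rightarrow> 'i \<Rightarrow> 'k" where "u i k = (if i = k then 1 else 0)" for i k
  \<comment> \<open>The rows of \<open>B\<close>, set to zero outside \<open>I\<close> to agree
    there with the unit vectors.\<close>
  define b where "b j k = (if k \<in> I then B j k else 0)" for j k
  have inj: "inj_on u S" for S
    by (rule inj_onI) (metis u_def zero_neq_one)
  have "independent (u ` I)"
  proof (rule independent_if_scalars_zero)
    fix f x assume 0: "(\<Sum>x \<in> u ` I. ?s (f x) x) = 0" and "x \<in> u ` I"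
    then obtain i where i: "i \<in> I" "x = u i" by auto
    have "0 = (\<Sum>x \<in> u ` I. ?s (f x) x) i" by (simp add: 0)
    also have "\<dots> = (\<Sum>k \<in> I. f (u k) * u k i)"
      by (simp add: sum_fun sum.reindex[OF inj])
    also have "\<dots> = f x"
      using i fin by (simp add: u_def if_distrib[of "(*) _"] sum.delta cong: if_cong)
    finally show "f x = 0" by simp
  qed (use fin in simp)
  moreover have "u ` I \<subseteq> span (b ` J)"
  proof clarify
    fix i assume "i \<in> I"
    then have "u i = (\<Sum>j \<in> J. ?s (A i j) (b j))"
      using AB[of i] by (intro ext, rename_tac k, case_tac "k \<in> I") (auto simp: sum_fun u_def b_def)
    also have "\<dots> \<in> span (b ` J)"
      by (intro span_sum span_scale span_base) auto
    finally show "u i \<in> span (b ` J)" .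
  qed
  ultimately have "card (u ` I) \<le> card (b ` J)"
    using independent_span_bound[of "b ` J" "u ` I"] fin by auto
  also have "\<dots> \<le> card J"
    using fin by (intro card_image_le)
  finally show ?thesis by (simp add: card_image[OF inj])
qed

section \<open>From module isomorphisms to matrices over the field\<close>

definition unit_vec :: "('a, 'b) ring_scheme \<Rightarrow> nat \<Rightarrow> nat \<Rightarrow> nat \<Rightarrow> 'a" where
  "unit_vec R n k = (\<lambda>i\<in>{..<n}. if i = k then \<one>\<^bsub>R\<^esub> else \<zero>\<^bsub>R\<^esub>)"

text \<open>A matrix is a function of two indices, constrained on \<open>X\<close> alone. That
  \<open>X\<close> is nonempty excludes the zero ring, whose free modules of positive rank are all
  isomorphic.\<close>

locale matrix_representation = ring R for R (structure) +
  fixes \<rho> :: "'a \<Rightarrow> 'x \<Rightarrow> 'x \<Rightarrow> 'k :: field" and X :: "'x set"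
  assumes finite_X: "finite X" and X_nonempty: "X \<noteq> {}"
    and rho_add: "\<lbrakk>a \<in> carrier R; b \<in> carrier R; x \<in> X; y \<in> X\<rbrakk>
      \<Longrightarrow> \<rho> (a \<oplus> b) x y = \<rho> a x y + \<rho> b x y"
    and rho_mult: "\<lbrakk>a \<in> carrier R; b \<in> carrier R; x \<in> X; z \<in> X\<rbrakk>
      \<Longrightarrow> \<rho> (a \<otimes> b) x z = (\<Sum>y \<in> X. \<rho> a x y * \<rho> b y z)"
    and rho_one: "\<lbrakk>x \<in> X; y \<in> X\<rbrakk> \<Longrightarrow> \<rho> \<one> x y = (if x = y then 1 else 0)"
begin

lemma rho_zero: "x \<in> X \<Longrightarrow> y \<in> X \<Longrightarrow> \<rho> \<zero> x y = 0"
  using rho_add[of \<zero> \<zero> x y] by (simp only: zero_closed l_zero add_cancel_right_right)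

text \<open>A right-linear map is left multiplication by the matrix whose columns are the images of
  the unit vectors; \<open>\<rho>\<close> turns each of its entries into an \<open>X\<close> by
  \<open>X\<close> block.\<close>

lemma rho_linear_map:
  assumes iso: "free_right_module_iso R m n \<phi>" and v: "v \<in> free_right_module R m"
    and i: "i < n" and x: "x \<in> X" and z: "z \<in> X"
  shows "\<rho> (\<phi> v i) x z = (\<Sum>j<m. \<Sum>y \<in> X. \<rho> (\<phi> (unit_vec R m j) i) x y * \<rho> (v j) y z)"
proof -
  let ?M = "free_right_module R m"
  have map: "\<phi> w i \<in> carrier R" if "w \<in> ?M" for w
    using iso that i by (auto simp: free_right_module_iso_def bij_betw_def free_right_module_def)
  have add: "\<phi> (\<lambda>i\<in>{..<m}. v i \<oplus> w i) i = \<phi> v i \<oplus> \<phi> w i" if "v \<in> ?M" "w \<in> ?M" for v w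
    using iso that i by (auto simp: free_right_module_iso_def)
  have scale: "\<phi> (\<lambda>i\<in>{..<m}. v i \<otimes> r) i = \<phi> v i \<otimes> r" if "v \<in> ?M" "r \<in> carrier R" for v r
    using iso that i by (auto simp: free_right_module_iso_def)
  have vc: "v j \<in> carrier R" if "j < m" for j
    using v that by (auto simp: free_right_module_def)
  \<comment> \<open>Truncation of \<open>v\<close> to its first \<open>l\<close> coordinates; the
    formula is proved by adding one coordinate at a time.\<close>
  define p where "p l = (\<lambda>j\<in>{..<m}. if j < l then v j else \<zero>)" for l
  have p: "p l \<in> ?M" for l
    using vc by (auto simp: p_def free_right_module_def)
  have u: "unit_vec R m l \<in> ?M" for l
    by (auto simp: unit_vec_def free_right_module_def)
  have "\<rho> (\<phi> (p l) i) x z = (\<Sum>j<l. \<Sum>y \<in> X. \<rho> (\<phi> (unit_vec R m j) i) x y * \<rho> (v j) y z)" if "l \<le> m" for l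
    using that
  proof (induction l)
    case 0
    \<comment> \<open>The zero vector equals its own double, so the entry of its image equals its
      own double too and vanishes.\<close>
    have "(\<lambda>j\<in>{..<m}. p 0 j \<oplus> p 0 j) = p 0"
      by (auto simp: p_def fun_eq_iff)
    then have "\<rho> (\<phi> (p 0) i) x z = \<rho> (\<phi> (p 0) i) x z + \<rho> (\<phi> (p 0) i) x z"
      using add[OF p p, of 0 0] rho_add[OF map[OF p] map[OF p] x z, of 0 0] by simp
    then have "\<rho> (\<phi> (p 0) i) x z = 0" by (simp only: add_cancel_right_right)
    then show ?case by simp
  next
    case (Suc l)
    let ?w = "\<lambda>j\<in>{..<m}. unit_vec R m l j \<otimes> v l"
    have w: "?w \<in> ?M"
      using vc[of l] Suc.prems by (auto simp: unit_vec_def free_right_module_def)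
    have "p (Suc l) = (\<lambda>j\<in>{..<m}. p l j \<oplus> ?w j)"
      using vc Suc.prems by (auto simp: p_def unit_vec_def fun_eq_iff less_Suc_eq)
    then have "\<phi> (p (Suc l)) i = \<phi> (p l) i \<oplus> \<phi> (unit_vec R m l) i \<otimes> v l"
      using add[OF p w] scale[OF u vc, of l l] Suc.prems by simp
    then have "\<rho> (\<phi> (p (Suc l)) i) x z = \<rho> (\<phi> (p l) i) x z
        + (\<Sum>y \<in> X. \<rho> (\<phi> (unit_vec R m l) i) x y * \<rho> (v l) y z)"
      using map[OF p] map[OF u] vc[of l] x z Suc.prems by (simp add: rho_add rho_mult)
    then show ?case using Suc by simp
  qed
  moreover have "p m = restrict v {..<m}"
    by (auto simp: p_def)
  then have "p m = v"
    using v by (simp add: free_right_module_def PiE_restrict)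
  ultimately show ?thesis by auto
qed

text \<open>Preimages of the unit vectors under the surjection \<open>\<phi>\<close> are the columns
  of a right inverse of its matrix. After applying \<open>\<rho>\<close> this compares
  \<open>n * card X\<close> with \<open>m * card X\<close>.\<close>

lemma iso_imp_le:
  assumes iso: "free_right_module_iso R m n \<phi>"
  shows "n \<le> m"
proof -
  have u: "unit_vec R n k \<in> free_right_module R n" for k
    by (auto simp: unit_vec_def free_right_module_def)
  moreover have "\<phi> ` free_right_module R m = free_right_module R n"
    using iso by (simp add: free_right_module_iso_def bij_betw_def)
  ultimately have "\<exists>v \<in> free_right_module R m. \<phi> v = unit_vec R n k" for k
    by (metis imageE)
  then obtain w where w: "\<And>k. w k \<in> free_right_module R m" "\<And>k. \<phi> (w k) = unit_vec R n k"
    by metis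
  have "card ({..<n} \<times> X) \<le> card ({..<m} \<times> X)"
  proof (rule card_le_if_matrix_right_inverse)
    fix p q assume pq: "p \<in> {..<n} \<times> X" "q \<in> {..<n} \<times> X"
    obtain i x k z where [simp]: "p = (i, x)" "q = (k, z)" by (cases p; cases q)
    have "(\<Sum>r \<in> {..<m} \<times> X. \<rho> (\<phi> (unit_vec R m (fst r)) (fst p)) (snd p) (snd r)
        * \<rho> (w (fst q) (fst r)) (snd r) (snd q)) = \<rho> (\<phi> (w k) i) x z"
      using rho_linear_map[OF iso w(1), of i x z k] pq by (simp add: sum.cartesian_product case_prod_beta)
    also have "\<dots> = (if p = q then 1 else 0)"
      using pq by (auto simp: w(2) unit_vec_def rho_one rho_zero)
    finally show "(\<Sum>r \<in> {..<m} \<times> X. \<rho> (\<phi> (unit_vec R m (fst r)) (fst p)) (snd p) (snd r)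
        * \<rho> (w (fst q) (fst r)) (snd r) (snd q)) = (if p = q then 1 else 0)" .
  qed (use finite_X in auto)
  then show ?thesis
    using finite_X X_nonempty by (simp add: card_cartesian_product card_gt_0_iff)
qed

end

lemma (in ring) free_right_module_iso_inv:
  assumes iso: "free_right_module_iso R m n \<phi>"
  shows "free_right_module_iso R n m (inv_into (free_right_module R m) \<phi>)" (is "free_right_module_iso R n m ?\<psi>")
proof -
  let ?M = "free_right_module R m" and ?N = "free_right_module R n"
  have bij: "bij_betw \<phi> ?M ?N" using iso by (simp add: free_right_module_iso_def)
  have psi: "?\<psi> y \<in> ?M" "\<phi> (?\<psi> y) = y" if "y \<in> ?N" for y
    using bij that by (auto simp: bij_betw_def inv_into_into f_inv_into_f)
  have inv: "?\<psi> y = x" if "x \<in> ?M" "\<phi> x = y" for x y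
    using bij that by (auto simp: bij_betw_def)
  have addc: "(\<lambda>i\<in>{..<m}. x i \<oplus> y i) \<in> ?M" if "x \<in> ?M" "y \<in> ?M" for x y
    using that by (auto simp: free_right_module_def)
  have scalec: "(\<lambda>i\<in>{..<m}. x i \<otimes> r) \<in> ?M" if "x \<in> ?M" "r \<in> carrier R" for x r
    using that by (auto simp: free_right_module_def)
  have "?\<psi> (\<lambda>i\<in>{..<n}. x i \<oplus> y i) = (\<lambda>i\<in>{..<m}. ?\<psi> x i \<oplus> ?\<psi> y i)" if "x \<in> ?N" "y \<in> ?N" for x y
    using iso psi[OF that(1)] psi[OF that(2)] by (intro inv addc) (auto simp: free_right_module_iso_def)
  moreover have "?\<psi> (\<lambda>i\<in>{..<n}. x i \<otimes> r) = (\<lambda>i\<in>{..<m}. ?\<psi> x i \<otimes> r)" if "x \<in> ?N" "r \<in> carrier R" for x r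
    using iso psi[OF that(1)] that(2) by (intro inv scalec) (auto simp: free_right_module_iso_def)
  ultimately show ?thesis
    using bij_betw_inv_into[OF bij] by (simp add: free_right_module_iso_def)
qed

theorem (in matrix_representation) invariant_basis_number: "invariant_basis_number R"
  unfolding invariant_basis_number_def
  using ring_axioms iso_imp_le free_right_module_iso_inv by (blast intro: antisym)

section \<open>The Leavitt path algebra as a ring\<close>

lemma poly_mapping_eq_sum_single:
  fixes f :: "'a \<Rightarrow>\<^sub>0 'b :: comm_monoid_add"
  shows "f = (\<Sum>w \<in> Poly_Mapping.keys f. Poly_Mapping.single w (Poly_Mapping.lookup f w))"
  by (rule poly_mapping_eqI)
    (auto simp: lookup_sum lookup_single when_def sum.delta in_keys_iff)

text \<open>Reduces additive statements about the free algebra to scalar multiples of single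
  words.\<close>

lemma poly_mapping_additive_induct [case_names zero single add]:
  fixes f :: "'a \<Rightarrow>\<^sub>0 'b :: comm_monoid_add"
  assumes "P 0" "\<And>w c. P (Poly_Mapping.single w c)" "\<And>f g. P f \<Longrightarrow> P g \<Longrightarrow> P (f + g)"
  shows "P f"
proof -
  have "P (\<Sum>w \<in> A. Poly_Mapping.single w (Poly_Mapping.lookup f w))" for A
    by (induction A rule: infinite_finite_induct) (auto intro: assms)
  then show ?thesis by (metis poly_mapping_eq_sum_single)
qed

section \<open>Computing with cosets of the Leavitt ideal\<close>

context wf_digraph
begin

lemma free_algebra_a_inv:
  assumes "f \<in> carrier (free_algebra G)"
  shows "\<ominus>\<^bsub>free_algebra G\<^esub> f = - (f :: ('k :: field, 'a, 'b) free_alg)"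
proof -
  have "- f \<in> carrier (free_algebra G)"
    using assms by (simp add: free_algebra_def)
  then show ?thesis
    using assms
    by (intro abelian_group.minus_equality ring.is_abelian_group free_algebra_ring)
      (auto simp: free_algebra_simps)
qed

lemma leavitt_ideal_closed:
  fixes f g :: "('k :: field, 'a, 'b) free_alg"
  shows "f \<in> leavitt_ideal G \<Longrightarrow> f \<in> carrier (free_algebra G)"
    and "0 \<in> (leavitt_ideal G :: ('k, 'a, 'b) free_alg set)"
    and "f \<in> leavitt_ideal G \<Longrightarrow> g \<in> leavitt_ideal G \<Longrightarrow> f + g \<in> leavitt_ideal G"
    and "f \<in> leavitt_ideal G \<Longrightarrow> g \<in> leavitt_ideal G \<Longrightarrow> f - g \<in> leavitt_ideal G"
    and "f \<in> leavitt_ideal G \<Longrightarrow> g \<in> carrier (free_algebra G) \<Longrightarrow> f * g \<in> leavitt_ideal G"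
    and "f \<in> leavitt_ideal G \<Longrightarrow> g \<in> carrier (free_algebra G) \<Longrightarrow> g * f \<in> leavitt_ideal G"
    and "f \<in> leavitt_relations G \<Longrightarrow> f \<in> leavitt_ideal G"
proof -
  interpret I: ideal "leavitt_ideal G :: ('k, 'a, 'b) free_alg set" "free_algebra G"
    by (rule leavitt_ideal_ideal) (rule wf_digraph_axioms)
  show carr: "f \<in> leavitt_ideal G \<Longrightarrow> f \<in> carrier (free_algebra G)" for f :: "('k, 'a, 'b) free_alg"
    by (rule I.a_Hcarr)
  show "0 \<in> (leavitt_ideal G :: ('k, 'a, 'b) free_alg set)"
    using additive_subgroup.zero_closed[OF I.is_additive_subgroup] by (simp add: free_algebra_simps)
  show add: "f \<in> leavitt_ideal G \<Longrightarrow> g \<in> leavitt_ideal G \<Longrightarrow> f + g \<in> leavitt_ideal G" for f g :: "('k, 'a, 'b) free_alg"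
    using additive_subgroup.a_closed[OF I.is_additive_subgroup, of f g] by (simp add: free_algebra_simps)
  show "f - g \<in> leavitt_ideal G" if "f \<in> leavitt_ideal G" "g \<in> leavitt_ideal G"
  proof -
    have "(- 1) * g \<in> leavitt_ideal G"
      using I.I_l_closed[OF that(2), of "- 1"] by (simp add: free_algebra_def zero_fword_def)
    then show ?thesis using add[OF that(1), of "- g"] by simp
  qed
  show "f \<in> leavitt_ideal G \<Longrightarrow> g \<in> carrier (free_algebra G) \<Longrightarrow> f * g \<in> leavitt_ideal G"
    using I.I_r_closed[of f g] by (simp add: free_algebra_simps)
  show "f \<in> leavitt_ideal G \<Longrightarrow> g \<in> carrier (free_algebra G) \<Longrightarrow> g * f \<in> leavitt_ideal G"
    using I.I_l_closed[of f g] by (simp add: free_algebra_simps)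
  have "leavitt_relations G \<subseteq> carrier (free_algebra G :: ('k, 'a, 'b) free_alg ring)"
    using leavitt_relations_subset[OF wf_digraph_axioms] by (auto simp: free_nonunital_def)
  then show "f \<in> leavitt_relations G \<Longrightarrow> f \<in> leavitt_ideal G"
    using ring.genideal_self[OF free_algebra_ring] unfolding leavitt_ideal_def by blast
qed

lemma sum_in_leavitt_ideal:
  "(\<And>s. s \<in> S \<Longrightarrow> f s \<in> leavitt_ideal G) \<Longrightarrow> sum f S \<in> (leavitt_ideal G :: ('k :: field, 'a, 'b) free_alg set)"
  by (induction S rule: infinite_finite_induct) (auto intro: leavitt_ideal_closed)

abbreviation leavitt_coset :: "('k :: field, 'a, 'b) free_alg \<Rightarrow> ('k, 'a, 'b) free_alg set" where
  "leavitt_coset f \<equiv> leavitt_ideal G +>\<^bsub>free_algebra G\<^esub> f"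

lemma leavitt_coset_eq_iff:
  fixes f g :: "('k :: field, 'a, 'b) free_alg"
  assumes "f \<in> carrier (free_algebra G)" "g \<in> carrier (free_algebra G)"
  shows "leavitt_coset f = leavitt_coset g \<longleftrightarrow> f - g \<in> leavitt_ideal G"
  using ring.quotient_eq_iff_same_a_r_cos[OF free_algebra_ring leavitt_ideal_ideal[OF wf_digraph_axioms] assms]
  by (simp add: a_minus_def free_algebra_a_inv free_algebra_simps assms)

lemma leavitt_coset_ops:
  fixes f g :: "('k :: field, 'a, 'b) free_alg"
  assumes "f \<in> carrier (free_algebra G)" "g \<in> carrier (free_algebra G)"
  shows "leavitt_coset f \<oplus>\<^bsub>leavitt_path_algebra TYPE('k) G\<^esub> leavitt_coset g = leavitt_coset (f + g)"
    and "leavitt_coset f \<otimes>\<^bsub>leavitt_path_algebra TYPE('k) G\<^esub> leavitt_coset g = leavitt_coset (f * g)"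
proof -
  have hom: "(+>\<^bsub>free_algebra G\<^esub>) (leavitt_ideal G) \<in> ring_hom (free_algebra G) (free_algebra G Quot (leavitt_ideal G :: ('k, 'a, 'b) free_alg set))"
    by (rule ideal.rcos_ring_hom[OF leavitt_ideal_ideal[OF wf_digraph_axioms]])
  show "leavitt_coset f \<oplus>\<^bsub>leavitt_path_algebra TYPE('k) G\<^esub> leavitt_coset g = leavitt_coset (f + g)"
    using ring_hom_add[OF hom assms] by (simp add: leavitt_path_algebra_def free_algebra_simps)
  show "leavitt_coset f \<otimes>\<^bsub>leavitt_path_algebra TYPE('k) G\<^esub> leavitt_coset g = leavitt_coset (f * g)"
    using ring_hom_mult[OF hom assms] by (simp add: leavitt_path_algebra_def free_algebra_simps)
qed

lemma leavitt_zero: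
  "\<zero>\<^bsub>leavitt_path_algebra TYPE('k :: field) G\<^esub> = leavitt_coset (0 :: ('k, 'a, 'b) free_alg)"
proof -
  interpret I: ideal "leavitt_ideal G :: ('k, 'a, 'b) free_alg set" "free_algebra G"
    by (rule leavitt_ideal_ideal) (rule wf_digraph_axioms)
  have "leavitt_ideal G = leavitt_coset (0 :: ('k, 'a, 'b) free_alg)"
    by (rule I.a_rcos_zero[OF I.ideal_axioms leavitt_ideal_closed(2), symmetric])
  then show ?thesis by (simp add: leavitt_path_algebra_def FactRing_def)
qed

end

section \<open>The sum of the vertices as identity element\<close>

definition vertex_sum :: "('v, 'e) pre_digraph \<Rightarrow> ('k :: field, 'v, 'e) free_alg" where
  "vertex_sum E = (\<Sum>v \<in> verts E. vert v)"

lemma gen_elem_closed: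
  "g \<in> graph_gens E \<Longrightarrow> gen_elem g \<in> carrier (free_algebra E)"
  using gen_elem_in_free_nonunital[of g E] by (auto simp: free_nonunital_def)

lemma vertex_sum_nonunital: "vertex_sum E \<in> (free_nonunital E :: ('k :: field, 'v, 'e) free_alg set)"
proof -
  have "(\<Sum>v \<in> A. vert v) \<in> (free_nonunital E :: ('k, 'v, 'e) free_alg set)" if "A \<subseteq> verts E" for A
    using that by (induction A rule: infinite_finite_induct)
      (auto intro!: free_nonunital_closed(1) gen_elem_in_free_nonunital simp: graph_gens_def,
       auto simp: free_nonunital_def free_algebra_def)
  then show ?thesis by (simp add: vertex_sum_def)
qed

context fin_digraph
begin

lemma vertex_sum_vertex:
  assumes "u \<in> verts G"
  shows "vertex_sum G * vert u - vert u \<in> (leavitt_ideal G :: ('k :: field, 'a, 'b) free_alg set)"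
    and "vert u * vertex_sum G - vert u \<in> (leavitt_ideal G :: ('k :: field, 'a, 'b) free_alg set)"
proof -
  have rel: "vert v * vert w - (if v = w then vert w else 0) \<in> (leavitt_ideal G :: ('k, 'a, 'b) free_alg set)"
    if "v \<in> verts G" "w \<in> verts G" for v w
    using that by (intro leavitt_ideal_closed(7)) (auto simp: leavitt_relations_def)
  \<comment> \<open>Each summand on the right is an instance of the orthogonality relation for
    vertices.\<close>
  have "vertex_sum G * vert u - (vert u :: ('k, 'a, 'b) free_alg)
      = (\<Sum>v \<in> verts G. vert v * vert u - (if v = u then vert u else 0))"
    using assms by (simp add: vertex_sum_def sum_distrib_right sum_subtractf sum.delta)
  then show "vertex_sum G * vert u - vert u \<in> (leavitt_ideal G :: ('k, 'a, 'b) free_alg set)"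
    using rel assms by (auto intro: sum_in_leavitt_ideal)
  have "vert u * vertex_sum G - (vert u :: ('k, 'a, 'b) free_alg)
      = (\<Sum>v \<in> verts G. vert u * vert v - (if u = v then vert v else 0))"
    using assms by (simp add: vertex_sum_def sum_distrib_left sum_subtractf)
  then show "vert u * vertex_sum G - vert u \<in> (leavitt_ideal G :: ('k, 'a, 'b) free_alg set)"
    using rel assms by (auto intro: sum_in_leavitt_ideal)
qed

text \<open>Every generator \<open>g\<close> absorbs some vertex \<open>u\<close> on the left and
  some vertex \<open>w\<close> on the right. Modulo the ideal, with \<open>s\<close> the vertex sum,
  \<open>s g = s u g = u g = g\<close>, and likewise on the right.\<close>

lemma vertex_sum_gen:
  assumes "g \<in> graph_gens G"
  shows "vertex_sum G * gen_elem g - gen_elem g \<in> (leavitt_ideal G :: ('k :: field, 'a, 'b) free_alg set)"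
    and "gen_elem g * vertex_sum G - gen_elem g \<in> (leavitt_ideal G :: ('k :: field, 'a, 'b) free_alg set)"
proof -
  let ?I = "leavitt_ideal G :: ('k, 'a, 'b) free_alg set" and ?e = "vertex_sum G :: ('k, 'a, 'b) free_alg"
  let ?g = "gen_elem g :: ('k, 'a, 'b) free_alg"
  have e: "?e \<in> carrier (free_algebra G)"
    using vertex_sum_nonunital[of G] by (auto simp: free_nonunital_def)
  have g: "?g \<in> carrier (free_algebra G)" using assms by (rule gen_elem_closed)
  have rel: "f \<in> ?I" if "f \<in> leavitt_relations G" for f
    using that by (rule leavitt_ideal_closed(7))
  obtain u w where uw: "u \<in> verts G" "w \<in> verts G" "vert u * ?g - ?g \<in> ?I" "?g * vert w - ?g \<in> ?I"
  proof -
    consider v where "g = Vertex v" "v \<in> verts G" | a where "g = Edge a" "a \<in> arcs G"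
      | a where "g = Ghost a" "a \<in> arcs G"
      using assms by (auto simp: graph_gens_def)
    then show thesis
    proof cases
      case (1 v)
      have "vert v * vert v - (if v = v then vert v else 0) \<in> (leavitt_relations G :: ('k, 'a, 'b) free_alg set)"
        unfolding leavitt_relations_def using 1(2) by blast
      then have "vert v * ?g - ?g \<in> ?I" "?g * vert v - ?g \<in> ?I"
        using 1(1) by (auto intro: rel)
      with 1(2) show thesis by (intro that)
    next
      case (2 a)
      then show thesis
        by (intro that[of "tail G a" "head G a"] rel) (auto simp: leavitt_relations_def)
    next
      case (3 a)
      then show thesis
        by (intro that[of "head G a" "tail G a"] rel) (auto simp: leavitt_relations_def)
    qed
  qed
  have "?e * ?g - ?g = (?e * vert u - vert u) * ?g + (vert u * ?g - ?g) - ?e * (vert u * ?g - ?g)"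
    by (simp add: algebra_simps)
  moreover have "(?e * vert u - vert u) * ?g \<in> ?I" "?e * (vert u * ?g - ?g) \<in> ?I"
    using uw(1,3) e g vertex_sum_vertex(1) by (blast intro: leavitt_ideal_closed(5,6))+
  ultimately show "?e * ?g - ?g \<in> ?I"
    using uw(3) by (simp only: leavitt_ideal_closed(3,4))
  have "?g * ?e - ?g = ?g * (vert w * ?e - vert w) + (?g * vert w - ?g) - (?g * vert w - ?g) * ?e"
    by (simp add: algebra_simps)
  moreover have "?g * (vert w * ?e - vert w) \<in> ?I" "(?g * vert w - ?g) * ?e \<in> ?I"
    using uw(2,4) e g vertex_sum_vertex(2) by (blast intro: leavitt_ideal_closed(5,6))+
  ultimately show "?g * ?e - ?g \<in> ?I"
    using uw(4) by (simp only: leavitt_ideal_closed(3,4))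
qed

text \<open>Without a constant term, every word of \<open>f\<close> has a first and a last letter,
  to which the case of a generator applies.\<close>

lemma vertex_sum_unit:
  fixes f :: "('k :: field, 'a, 'b) free_alg"
  assumes "f \<in> free_nonunital G"
  shows "vertex_sum G * f - f \<in> leavitt_ideal G" and "f * vertex_sum G - f \<in> leavitt_ideal G"
proof -
  let ?e = "vertex_sum G :: ('k, 'a, 'b) free_alg"
  let ?t = "\<lambda>w. Poly_Mapping.single w (Poly_Mapping.lookup f w)"
  have "?e * ?t w - ?t w \<in> leavitt_ideal G \<and> ?t w * ?e - ?t w \<in> leavitt_ideal G"
    if w: "w \<in> Poly_Mapping.keys f" for w
  proof -
    have "letters w \<noteq> []"
      using assms w by (cases w) (auto simp: free_nonunital_def zero_fword_def in_keys_iff)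
    have gens: "set (letters w) \<subseteq> graph_gens G"
      using assms w by (auto simp: free_nonunital_def free_algebra_def)
    let ?s = "\<lambda>gs. Poly_Mapping.single (Word gs) (Poly_Mapping.lookup f w)"
    have s: "?s gs \<in> carrier (free_algebra G)" if "set gs \<subseteq> graph_gens G" for gs
      using that by (auto simp: free_algebra_def)
    from \<open>letters w \<noteq> []\<close> obtain g gs where "letters w = g # gs" by (cases "letters w") auto
    then have "?t w = gen_elem g * ?s gs" and g: "g \<in> graph_gens G" "set gs \<subseteq> graph_gens G"
      using gens by (cases w; auto simp: gen_elem_def mult_single plus_fword_def)+
    then have "?e * ?t w - ?t w = (?e * gen_elem g - gen_elem g) * ?s gs"
      by (simp add: algebra_simps)
    then have 1: "?e * ?t w - ?t w \<in> leavitt_ideal G"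
      using leavitt_ideal_closed(5)[OF vertex_sum_gen(1)[OF g(1)] s[OF g(2)]] by simp
    from \<open>letters w \<noteq> []\<close> obtain g gs where "letters w = gs @ [g]" by (cases "letters w" rule: rev_cases) auto
    then have "?t w = ?s gs * gen_elem g" and g: "g \<in> graph_gens G" "set gs \<subseteq> graph_gens G"
      using gens by (cases w; auto simp: gen_elem_def mult_single plus_fword_def)+
    then have "?t w * ?e - ?t w = ?s gs * (gen_elem g * ?e - gen_elem g)"
      by (simp add: algebra_simps)
    then have "?t w * ?e - ?t w \<in> leavitt_ideal G"
      using leavitt_ideal_closed(6)[OF vertex_sum_gen(2)[OF g(1)] s[OF g(2)]] by simp
    with 1 show ?thesis by simp
  qed
  then have "(\<Sum>w \<in> Poly_Mapping.keys f. ?e * ?t w - ?t w) \<in> leavitt_ideal G"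
    "(\<Sum>w \<in> Poly_Mapping.keys f. ?t w * ?e - ?t w) \<in> leavitt_ideal G"
    by (auto intro!: sum_in_leavitt_ideal)
  then show "?e * f - f \<in> leavitt_ideal G" "f * ?e - f \<in> leavitt_ideal G"
    by (simp_all add: sum_subtractf flip: sum_distrib_left sum_distrib_right poly_mapping_eq_sum_single)
qed

text \<open>The algebra is a part of the quotient of the free algebra with an identity of its own,
  so the ring laws are transferred through representatives and the unit laws come from
  \<open>vertex_sum_unit\<close>.\<close>

lemma leavitt_path_algebra_ring: "ring (leavitt_path_algebra TYPE('k :: field) G)"
proof -
  let ?L = "leavitt_path_algebra TYPE('k) G" and ?N = "free_nonunital G :: ('k, 'a, 'b) free_alg set"
  have carr: "carrier ?L = leavitt_coset ` ?N"
    by (simp add: leavitt_path_algebra_def)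
  have N: "f \<in> carrier (free_algebra G)" if "f \<in> ?N" for f
    using that by (simp add: free_nonunital_def)
  have one: "\<one>\<^bsub>?L\<^esub> = leavitt_coset (vertex_sum G)"
    by (simp add: leavitt_path_algebra_def vertex_sum_def)
  have zero: "0 \<in> ?N" by (simp add: free_nonunital_def free_algebra_def)
  have neg: "- f \<in> ?N" if "f \<in> ?N" for f
    using that free_nonunital_closed(2)[OF zero that] by simp
  have add: "f + g \<in> ?N" and mult: "f * g \<in> ?N" if "f \<in> ?N" "g \<in> ?N" for f g
    using that by (auto intro: free_nonunital_closed N)
  note ops = leavitt_coset_ops[OF N N]
  have unit: "leavitt_coset (vertex_sum G * f) = leavitt_coset f"
    "leavitt_coset (f * vertex_sum G) = leavitt_coset f" if "f \<in> ?N" for f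
    using that by (simp_all add: leavitt_coset_eq_iff N mult vertex_sum_nonunital vertex_sum_unit)
  show ?thesis
  proof (rule ringI)
    show "abelian_group ?L"
    proof (rule abelian_groupI)
      fix x assume "x \<in> carrier ?L"
      then obtain f where f: "f \<in> ?N" "x = leavitt_coset f" by (auto simp: carr)
      then show "\<exists>y \<in> carrier ?L. y \<oplus>\<^bsub>?L\<^esub> x = \<zero>\<^bsub>?L\<^esub>"
        using neg by (intro bexI[of _ "leavitt_coset (- f)"]) (auto simp: carr ops leavitt_zero)
    qed (auto simp: carr ops add leavitt_zero zero ac_simps)
    show "monoid ?L"
      by (rule monoidI)
        (auto simp: carr one ops mult vertex_sum_nonunital mult.assoc unit)
  qed (auto simp: carr ops add mult algebra_simps)
qed

end

section \<open>The representation given by a balanced weight\<close>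

text \<open>Letters act from left to right, so that concatenation of words becomes the product of
  matrices in the same order. \<open>None\<close> stands for the zero vector.\<close>

primrec word_map :: "('g \<Rightarrow> 'x \<Rightarrow> 'x option) \<Rightarrow> 'g list \<Rightarrow> 'x \<Rightarrow> 'x option" where
  "word_map \<tau> [] x = Some x"
| "word_map \<tau> (g # gs) x = Option.bind (\<tau> g x) (word_map \<tau> gs)"

lemma word_map_append:
  "word_map \<tau> (gs @ hs) x = Option.bind (word_map \<tau> gs x) (word_map \<tau> hs)"
  by (induction gs arbitrary: x) (auto split: Option.bind_splits)

locale partial_action =
  fixes \<tau> :: "'g \<Rightarrow> 'x \<Rightarrow> 'x option" and X :: "'x set"
  assumes finite_X: "finite X"
    and tau_closed: "x \<in> X \<Longrightarrow> \<tau> g x = Some y \<Longrightarrow> y \<in> X"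
begin

lemma word_map_closed: "x \<in> X \<Longrightarrow> word_map \<tau> gs x = Some y \<Longrightarrow> y \<in> X"
  by (induction gs arbitrary: x) (auto split: Option.bind_splits dest: tau_closed)

text \<open>The linear extension to the free algebra of the 0-1 matrices of the partial maps; row
  \<open>x\<close> is the image of the basis vector \<open>x\<close>.\<close>

definition action_matrix :: "('g fword \<Rightarrow>\<^sub>0 'k :: field) \<Rightarrow> 'x \<Rightarrow> 'x \<Rightarrow> 'k" where
  "action_matrix f x y = (\<Sum>w \<in> Poly_Mapping.keys f.
     Poly_Mapping.lookup f w * (if word_map \<tau> (letters w) x = Some y then 1 else 0))"

lemma action_matrix_0 [simp]: "action_matrix 0 x y = 0"
  by (simp add: action_matrix_def)

lemma action_matrix_single [simp]:
  "action_matrix (Poly_Mapping.single w c) x y = (if word_map \<tau> (letters w) x = Some y then c else 0)"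
  by (auto simp: action_matrix_def)

lemma action_matrix_add: "action_matrix (f + g) x y = action_matrix f x y + action_matrix g x y"
  unfolding action_matrix_def
  by (rule setsum_keys_plus_distrib) (auto simp: algebra_simps)

lemma action_matrix_diff: "action_matrix (f - g) x y = action_matrix f x y - action_matrix g x y"
  using action_matrix_add[of "f - g" g x y] by simp

lemma action_matrix_sum: "action_matrix (sum f S) x y = (\<Sum>s \<in> S. action_matrix (f s) x y)"
  by (induction S rule: infinite_finite_induct) (auto simp: action_matrix_add)

text \<open>By additivity in both factors two words suffice. The sum over \<open>y\<close> then has
  at most one nonzero term, at the image of \<open>x\<close> under the first word.\<close>

lemma action_matrix_mult:
  assumes "x \<in> X"
  shows "action_matrix (f * g) x z = (\<Sum>y \<in> X. action_matrix f x y * action_matrix g y z)"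
proof (induction f rule: poly_mapping_additive_induct)
  case (single u a)
  show ?case
  proof (induction g rule: poly_mapping_additive_induct)
    case (single w b)
    show ?case
    proof (cases "word_map \<tau> (letters u) x")
      case None
      then show ?thesis by (simp add: mult_single plus_fword_def word_map_append)
    next
      case (Some y)
      then have "y \<in> X" using assms word_map_closed by blast
      then show ?thesis
        using Some finite_X
        by (simp add: mult_single plus_fword_def word_map_append if_distrib[of "\<lambda>c. c * _"] sum.delta cong: if_cong)
    qed
  qed (simp_all add: action_matrix_add distrib_left sum.distrib)
qed (simp_all add: action_matrix_add distrib_right sum.distrib)

end

text \<open>The bijection \<open>\<sigma> v\<close> is the partition of \<open>{..<d v}\<close> into
  blocks: its first component names the block, the second the position in it.\<close>

locale balanced_weight = fin_digraph +
  fixes d :: "'a \<Rightarrow> nat" and \<sigma> :: "'a \<Rightarrow> nat \<Rightarrow> 'b \<times> nat"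
  assumes sigma: "regular_vertex G v \<Longrightarrow>
      bij_betw (\<sigma> v) {..<d v} (SIGMA e:out_arcs G v. {..<d (head G e)})"
begin

definition basis :: "('a \<times> nat) set" where
  "basis = (SIGMA v:verts G. {..<d v})"

text \<open>Edge \<open>e\<close> carries the block of \<open>e\<close> over its tail onto all
  indices over its head, and the ghost inverts this. The test \<open>e \<in> arcs G\<close> keeps
  \<open>basis\<close> closed under symbols foreign to the graph as well.\<close>

fun gen_map :: "('a, 'b) gen \<Rightarrow> 'a \<times> nat \<Rightarrow> ('a \<times> nat) option" where
  "gen_map (Vertex v) (u, i) = (if u = v then Some (u, i) else None)"
| "gen_map (Edge e) (u, i) =
     (if e \<in> arcs G \<and> u = tail G e \<and> fst (\<sigma> u i) = e then Some (head G e, snd (\<sigma> u i)) else None)"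
| "gen_map (Ghost e) (u, j) =
     (if e \<in> arcs G \<and> u = head G e
      then Some (tail G e, inv_into {..<d (tail G e)} (\<sigma> (tail G e)) (e, j)) else None)"

lemma tail_regular: "e \<in> arcs G \<Longrightarrow> regular_vertex G (tail G e)"
  by (auto simp: regular_vertex_def)

lemma sigma_props:
  assumes "regular_vertex G v" "i < d v"
  shows "fst (\<sigma> v i) \<in> out_arcs G v" "snd (\<sigma> v i) < d (head G (fst (\<sigma> v i)))"
    "inv_into {..<d v} (\<sigma> v) (\<sigma> v i) = i"
proof -
  have "\<sigma> v i \<in> (SIGMA e:out_arcs G v. {..<d (head G e)})"
    using sigma[OF assms(1)] assms(2) by (auto simp: bij_betw_def)
  then show "fst (\<sigma> v i) \<in> out_arcs G v" "snd (\<sigma> v i) < d (head G (fst (\<sigma> v i)))"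
    by (cases "\<sigma> v i"; auto)+
  show "inv_into {..<d v} (\<sigma> v) (\<sigma> v i) = i"
    using sigma[OF assms(1)] assms(2) by (auto simp: bij_betw_def)
qed

lemma inv_sigma_props:
  assumes "e \<in> arcs G" "j < d (head G e)"
  shows "inv_into {..<d (tail G e)} (\<sigma> (tail G e)) (e, j) < d (tail G e)"
    "\<sigma> (tail G e) (inv_into {..<d (tail G e)} (\<sigma> (tail G e)) (e, j)) = (e, j)"
proof -
  have ej: "(e, j) \<in> \<sigma> (tail G e) ` {..<d (tail G e)}"
    using sigma[OF tail_regular[OF assms(1)]] assms by (auto simp: bij_betw_def)
  show "inv_into {..<d (tail G e)} (\<sigma> (tail G e)) (e, j) < d (tail G e)"
    using inv_into_into[OF ej] by simp
  show "\<sigma> (tail G e) (inv_into {..<d (tail G e)} (\<sigma> (tail G e)) (e, j)) = (e, j)"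
    by (rule f_inv_into_f[OF ej])
qed

sublocale partial_action gen_map basis
proof
  show "finite basis" by (auto simp: basis_def)
  fix x g y assume "x \<in> basis" "gen_map g x = Some y"
  then show "y \<in> basis"
    using sigma_props(2)[OF tail_regular] inv_sigma_props(1)
    by (cases x; cases g) (auto simp: basis_def split: if_splits, metis)
qed

lemma action_matrix_gen: "action_matrix (gen_elem g) x y = (if gen_map g x = Some y then 1 else 0)"
  by (simp add: gen_elem_def) (simp split: Option.bind_splits)

lemma action_matrix_gen_mult:
  "action_matrix (gen_elem g * gen_elem h) x y = (if Option.bind (gen_map g x) (gen_map h) = Some y then 1 else 0)"
proof -
  have "word_map gen_map [h] = gen_map h"
    by (rule ext) (simp split: Option.bind_splits)
  then show ?thesis by (simp add: gen_elem_def mult_single plus_fword_def)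
qed

lemma action_matrix_relation:
  fixes f :: "('k :: field, 'a, 'b) free_alg"
  assumes "f \<in> leavitt_relations G" "x \<in> basis"
  shows "action_matrix f x y = 0"
proof -
  obtain u i where x: "x = (u, i)" "u \<in> verts G" "i < d u"
    using assms(2) by (auto simp: basis_def)
  note simps = action_matrix_diff action_matrix_gen action_matrix_gen_mult x
  consider (V) v w where "f = vert v * vert w - (if v = w then vert w else 0)"
    | (sE) e where "f = vert (tail G e) * edge e - edge e" "e \<in> arcs G"
    | (Er) e where "f = edge e * vert (head G e) - edge e" "e \<in> arcs G"
    | (rG) e where "f = vert (head G e) * ghost e - ghost e" "e \<in> arcs G"
    | (Gs) e where "f = ghost e * vert (tail G e) - ghost e" "e \<in> arcs G"
    | (CK1) e e' where "f = ghost e * edge e' - (if e = e' then vert (head G e) else 0)" "e \<in> arcs G" "e' \<in> arcs G"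
    | (CK2) v where "f = vert v - (\<Sum>e \<in> out_arcs G v. edge e * ghost e)" "regular_vertex G v"
    using assms(1) unfolding leavitt_relations_def by blast
  then show ?thesis
  proof cases
    case V
    then show ?thesis by (auto simp: simps)
  next
    case (CK1 e e')
    \<comment> \<open>The ghost, acting first, lands in the block of \<open>e\<close>, where
      \<open>e\<close> leads back to \<open>x\<close> and every other edge is undefined.\<close>
    have "Option.bind (gen_map (Ghost e) x) (gen_map (Edge e')) = (if u = head G e \<and> e = e' then Some x else None)"
    proof (cases "u = head G e")
      case True
      with x(3) have "\<sigma> (tail G e) (inv_into {..<d (tail G e)} (\<sigma> (tail G e)) (e, i)) = (e, i)"
        using inv_sigma_props(2)[OF CK1(2)] by simp
      with True CK1(2,3) show ?thesis by (auto simp: x(1))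
    qed (simp add: x(1))
    moreover have "gen_map (Vertex v) x = (if u = v then Some x else None)" for v
      by (simp add: x(1))
    ultimately show ?thesis
      unfolding CK1(1) action_matrix_diff action_matrix_gen_mult
      by (cases "e = e'") (simp_all add: action_matrix_gen)
  next
    case (CK2 v)
    \<comment> \<open>Edge followed by ghost is the identity on the block of \<open>e\<close>. Each
      index over \<open>v\<close> lies in exactly one block, so these projections add up to the
      action of \<open>v\<close>.\<close>
    have "Option.bind (gen_map (Edge e) x) (gen_map (Ghost e)) =
        (if u = v \<and> e = fst (\<sigma> u i) then Some x else None)" if "e \<in> out_arcs G v" for e
      using that sigma_props[of v i] CK2(2) x by auto
    then have "(\<Sum>e \<in> out_arcs G v. action_matrix (edge e * ghost e :: ('k, 'a, 'b) free_alg) x y)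
        = (\<Sum>e \<in> out_arcs G v. if e = fst (\<sigma> u i) then (if u = v \<and> x = y then 1 else 0) else 0)"
      by (intro sum.cong) (auto simp: action_matrix_gen_mult)
    also have "\<dots> = action_matrix (vert v) x y"
      using sigma_props(1)[of v i] CK2(2) x by (auto simp: action_matrix_gen sum.delta regular_vertex_def)
    finally show ?thesis
      using CK2(1) by (simp add: action_matrix_diff action_matrix_sum)
  qed (auto simp: simps)
qed

text \<open>The elements acting as zero on \<open>basis\<close> form an ideal containing the
  relations, hence contain the ideal these generate.\<close>

lemma action_matrix_ideal:
  assumes "f \<in> leavitt_ideal G" "x \<in> basis" "y \<in> basis"
  shows "action_matrix f x y = (0 :: 'k :: field)"
proof -
  let ?F = "free_algebra G :: ('k, 'a, 'b) free_alg ring"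
  let ?J = "{f \<in> carrier ?F. \<forall>x \<in> basis. \<forall>y \<in> basis. action_matrix f x y = 0}"
  interpret F: ring ?F by (rule free_algebra_ring)
  have "ideal ?J ?F"
  proof (rule idealI[OF free_algebra_ring])
    show "subgroup ?J (add_monoid ?F)"
    proof (rule F.add.subgroupI)
      show "?J \<noteq> {}"
        using F.zero_closed by (force simp: free_algebra_simps)
      fix a assume "a \<in> ?J"
      then show "\<ominus>\<^bsub>?F\<^esub> a \<in> ?J"
        using action_matrix_diff[of 0 a] F.a_inv_closed[of a] free_algebra_a_inv[of a] by auto
    qed (auto simp: free_algebra_simps action_matrix_add free_algebra_closed)
  qed (auto simp: free_algebra_simps action_matrix_mult free_algebra_closed)
  moreover have "leavitt_relations G \<subseteq> ?J"
    using leavitt_relations_subset[OF wf_digraph_axioms] action_matrix_relation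
    by (auto simp: free_nonunital_def)
  ultimately have "leavitt_ideal G \<subseteq> ?J"
    unfolding leavitt_ideal_def by (rule F.genideal_minimal)
  then show ?thesis using assms by auto
qed

text \<open>Representatives of a coset differ by an element of the ideal, so on \<open>basis\<close>
  the choice does not affect the entries.\<close>

definition coset_matrix :: "('k :: field, 'a, 'b) free_alg set \<Rightarrow> 'a \<times> nat \<Rightarrow> 'a \<times> nat \<Rightarrow> 'k" where
  "coset_matrix S = action_matrix (SOME f. f \<in> S)"

lemma coset_matrix_coset:
  fixes f :: "('k :: field, 'a, 'b) free_alg"
  assumes "f \<in> carrier (free_algebra G)" "x \<in> basis" "y \<in> basis"
  shows "coset_matrix (leavitt_coset f) x y = action_matrix f x y"
proof -
  interpret I: ideal "leavitt_ideal G :: ('k, 'a, 'b) free_alg set" "free_algebra G"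
    by (rule leavitt_ideal_ideal) (rule wf_digraph_axioms)
  define h where "h = (SOME h. h \<in> leavitt_coset f)"
  have "h \<in> leavitt_coset f"
    unfolding h_def using I.a_rcos_self[OF assms(1)] by (rule someI)
  then obtain k where "k \<in> leavitt_ideal G" "h = k + f"
    by (auto simp: a_r_coset_def' free_algebra_simps)
  then show ?thesis
    using action_matrix_ideal[of k] assms by (simp add: coset_matrix_def action_matrix_add flip: h_def)
qed

lemma leavitt_matrix_representation:
  assumes "basis \<noteq> {}"
  shows "matrix_representation (leavitt_path_algebra TYPE('k :: field) G) coset_matrix basis"
proof -
  interpret L: ring "leavitt_path_algebra TYPE('k) G" by (rule leavitt_path_algebra_ring)
  have carr: "carrier (leavitt_path_algebra TYPE('k) G) = leavitt_coset ` free_nonunital G"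
    by (simp add: leavitt_path_algebra_def)
  have one: "\<one>\<^bsub>leavitt_path_algebra TYPE('k) G\<^esub> = leavitt_coset (vertex_sum G)"
    by (simp add: leavitt_path_algebra_def vertex_sum_def)
  have N: "f \<in> carrier (free_algebra G)" if "f \<in> free_nonunital G" for f :: "('k, 'a, 'b) free_alg"
    using that by (simp add: free_nonunital_def)
  show ?thesis
  proof
    fix x y assume xy: "x \<in> basis" "y \<in> basis"
    \<comment> \<open>A vertex projects onto the basis elements over it, and each basis element lies
      over exactly one vertex; hence the vertex sum acts as the identity.\<close>
    have "action_matrix (vert v) x y = (if v = fst x then if x = y then 1 else 0 else (0 :: 'k))" for v
      by (cases x) (auto simp: action_matrix_gen)
    with xy show "coset_matrix \<one>\<^bsub>leavitt_path_algebra TYPE('k) G\<^esub> x y = (if x = y then 1 else 0)"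
      using N[OF vertex_sum_nonunital]
      by (auto simp: one coset_matrix_coset vertex_sum_def action_matrix_sum basis_def sum.delta)
  qed (use assms finite_X in \<open>auto simp: carr coset_matrix_coset leavitt_coset_ops N free_algebra_closed action_matrix_add action_matrix_mult\<close>)
qed

end

theorem corollary3p12:
  fixes E :: "('v, 'e) pre_digraph"
  assumes "fin_digraph E"
    and "verts E \<noteq> {}"
    and "disjoint_cycles E"
  shows "invariant_basis_number (leavitt_path_algebra TYPE('k :: field) E)"
proof -
  interpret E: fin_digraph E by fact
  obtain d :: "'v \<Rightarrow> nat" and v0 where d: "v0 \<in> verts E" "0 < d v0"
    "\<And>u. regular_vertex E u \<Longrightarrow> d u = (\<Sum>e \<in> out_arcs E u. d (head E e))"
    using E.exists_balanced_weight[OF assms(2,3)] by metis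
  \<comment> \<open>The balance equation says that both finite sets have the same
    cardinality.\<close>
  have "\<exists>f. bij_betw f {..<d v} (SIGMA e:out_arcs E v. {..<d (head E e)})" if "regular_vertex E v" for v
    using d(3)[OF that] that by (intro finite_same_card_bij) (auto simp: regular_vertex_def)
  then obtain \<sigma> where \<sigma>: "\<And>v. regular_vertex E v \<Longrightarrow>
      bij_betw (\<sigma> v) {..<d v} (SIGMA e:out_arcs E v. {..<d (head E e)})"
    by metis
  interpret balanced_weight E d \<sigma>
    by unfold_locales (rule \<sigma>)
  have "basis \<noteq> {}"
    using d(1,2) by (auto simp: basis_def)
  from matrix_representation.invariant_basis_number[OF leavitt_matrix_representation[OF this]]
  show ?thesis .
qed

end
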